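(* Let $\lambda_1=\lambda_2=\lambda>0$ and let $(u,v)$ be a blow-up solution, with (finite) blow-up time $T$, of the problem $$u_t=\Delta u+\lambda_1e^{v},\quad v_t=\Delta v+\lambda_2 e^{u}\quad\text{in } B_R\times(0,T),$$ $$\frac{\partial u}{\partial \eta}=e^{v},\quad \frac{\partial v}{\partial \eta}=e^{u}\quad\text{on }\partial B_R\times(0,T),$$ $$u(x,0)=u_0(x),\quad v(x,0)=v_0(x),\quad x\in B_R,$$ where the initial data $u_0,v_0$ satisfy the standing assumptions listed in the context. Assume moreover that $$u_{0r}(r)-\frac{r}{R}e^{v_0(r)}\ge 0,\qquad v_{0r}(r)-\frac{r}{R}e^{u_0(r)}\ge 0,\qquad r\in[0,R].$$ Then there is a positive constant $c$ such that $$\log c-\frac12\log(T-t)\le u(R,t),\qquad \log c-\frac12\log(T-t)\le v(R,t),\qquad t\in(0,T).$$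
   Context: $B_R\subset\mathbb{R}^n$ is the open ball of radius $R>0$ centered at the origin, $\partial B_R$ its boundary, $\eta$ the outward unit normal on $\partial B_R$. Solutions are classical; they are radial in $x$, and one writes $r=|x|$, $u(r,t)=u(x,t)$, with the subscript $r$ denoting the radial derivative. A blow-up solution with blow-up time $T<\infty$ is a classical solution whose maximal existence interval is $[0,T)$ and which becomes unbounded (in sup norm over $B_R$) as $t\to T^-$. Standing assumptions on the initial data: $u_0,v_0$ are nonnegative, radial, radially nondecreasing, smooth functions on $\overline{B}_R$ satisfying (a) $\frac{\partial u_0}{\partial\eta}=e^{v_0}$ and $\frac{\partial v_0}{\partial\eta}=e^{u_0}$ on $\partial B_R$; (b) $\Delta u_0+e^{v_0}\ge 0$ and $\Delta v_0+e^{u_0}\ge 0$ on $\overline{B}_R$; (c) $u_{0r}(|x|)\ge 0$ and $v_{0r}(|x|)\ge 0$ for $x\in\overline{B}_R$. *)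

theory Defs
  imports "HOL-Analysis.Analysis"
begin

definition partial :: "'a::euclidean_space \<Rightarrow> ('a \<Rightarrow> real) \<Rightarrow> 'a \<Rightarrow> real" where
  "partial i f x = deriv (\<lambda>s. f (x + s *\<^sub>R i)) 0"

definition has_partial :: "'a::euclidean_space \<Rightarrow> ('a \<Rightarrow> real) \<Rightarrow> 'a \<Rightarrow> bool" where
  "has_partial i f x \<longleftrightarrow> (\<lambda>s. f (x + s *\<^sub>R i)) differentiable (at 0)"

definition laplacian :: "('a::euclidean_space \<Rightarrow> real) \<Rightarrow> 'a \<Rightarrow> real" where
  "laplacian f x = (\<Sum>i\<in>Basis. partial i (partial i f) x)"

text \<open>Meant for open \<open>S\<close>: all iterated partial derivatives up to order \<open>k\<close> exist
  and are continuous on \<open>S\<close>.\<close>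

fun Ck_on :: "nat \<Rightarrow> 'a::euclidean_space set \<Rightarrow> ('a \<Rightarrow> real) \<Rightarrow> bool" where
  "Ck_on 0 S f \<longleftrightarrow> continuous_on S f"
| "Ck_on (Suc k) S f \<longleftrightarrow> continuous_on S f \<and>
     (\<forall>i\<in>Basis. (\<forall>x\<in>S. has_partial i f x) \<and> Ck_on k S (partial i f))"

text \<open>A function on a closed set \<open>K\<close> is smooth if it is the restriction of a smooth function on
  an open neighbourhood of \<open>K\<close>.  As HOL functions are total, \<open>f\<close> itself is taken to be such an
  extension; this makes its derivatives at boundary points of \<open>K\<close> meaningful.\<close>

definition smooth_on_closed :: "'a::euclidean_space set \<Rightarrow> ('a \<Rightarrow> real) \<Rightarrow> bool" where
  "smooth_on_closed K f \<longleftrightarrow> (\<exists>S. open S \<and> K \<subseteq> S \<and> (\<forall>k. Ck_on k S f))"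

text \<open>The parabolic class \<open>C\<^sup>2\<^sup>,\<^sup>1\<close> on \<open>\<Omega> \<times> (0,T)\<close>: two space derivatives and one
  time derivative, continuous jointly in space and time.\<close>

definition C21_on :: "'a::euclidean_space set \<Rightarrow> real \<Rightarrow> ('a \<Rightarrow> real \<Rightarrow> real) \<Rightarrow> bool" where
  "C21_on \<Omega> T u \<longleftrightarrow>
     continuous_on (\<Omega> \<times> {0<..<T}) (\<lambda>(x, t). u x t) \<and>
     (\<forall>x\<in>\<Omega>. \<forall>t\<in>{0<..<T}. u x differentiable (at t)) \<and>
     continuous_on (\<Omega> \<times> {0<..<T}) (\<lambda>(x, t). deriv (u x) t) \<and>
     (\<forall>i\<in>Basis.
        (\<forall>x\<in>\<Omega>. \<forall>t\<in>{0<..<T}. has_partial i (\<lambda>y. u y t) x) \<and>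
        continuous_on (\<Omega> \<times> {0<..<T}) (\<lambda>(x, t). partial i (\<lambda>y. u y t) x) \<and>
        (\<forall>j\<in>Basis.
           (\<forall>x\<in>\<Omega>. \<forall>t\<in>{0<..<T}. has_partial j (partial i (\<lambda>y. u y t)) x) \<and>
           continuous_on (\<Omega> \<times> {0<..<T}) (\<lambda>(x, t). partial j (partial i (\<lambda>y. u y t)) x)))"

text \<open>The derivative of \<open>f\<close> at \<open>x \<in> sphere 0 R\<close> along the outward unit normal \<open>x / R\<close>;
  it is one-sided, using only the values of \<open>f\<close> on the closed ball.\<close>

definition has_normal_derivative ::
    "real \<Rightarrow> ('a::euclidean_space \<Rightarrow> real) \<Rightarrow> real \<Rightarrow> 'a \<Rightarrow> bool" where
  "has_normal_derivative R f D x \<longleftrightarrow>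
     ((\<lambda>s. f (x + s *\<^sub>R (x /\<^sub>R R))) has_real_derivative D) (at 0 within {..0})"

definition radial_on :: "'a::euclidean_space set \<Rightarrow> ('a \<Rightarrow> real) \<Rightarrow> bool" where
  "radial_on S f \<longleftrightarrow> (\<forall>x\<in>S. \<forall>y\<in>S. norm x = norm y \<longrightarrow> f x = f y)"

text \<open>For a radial function the choice of the unit vector is immaterial:
  \<open>radial_profile f r\<close> is the value of \<open>f\<close> at every point of norm \<open>r\<close>.\<close>

definition radial_profile :: "('a::euclidean_space \<Rightarrow> real) \<Rightarrow> real \<Rightarrow> real" where
  "radial_profile f r = f (r *\<^sub>R (SOME e. norm e = 1))"

definition sup_norm_on :: "'a set \<Rightarrow> ('a \<Rightarrow> real) \<Rightarrow> real" where
  "sup_norm_on S f = (SUP x\<in>S. \<bar>f x\<bar>)"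

definition standing_assumptions ::
    "real \<Rightarrow> ('a::euclidean_space \<Rightarrow> real) \<Rightarrow> ('a \<Rightarrow> real) \<Rightarrow> bool" where
  "standing_assumptions R u0 v0 \<longleftrightarrow>
     (\<forall>x\<in>cball 0 R. 0 \<le> u0 x \<and> 0 \<le> v0 x) \<and>
     radial_on (cball 0 R) u0 \<and> radial_on (cball 0 R) v0 \<and>
     mono_on {0..R} (radial_profile u0) \<and> mono_on {0..R} (radial_profile v0) \<and>
     smooth_on_closed (cball 0 R) u0 \<and> smooth_on_closed (cball 0 R) v0 \<and>
     (\<forall>x\<in>sphere 0 R. has_normal_derivative R u0 (exp (v0 x)) x \<and>
                      has_normal_derivative R v0 (exp (u0 x)) x) \<and>
     (\<forall>x\<in>cball 0 R. 0 \<le> laplacian u0 x + exp (v0 x) \<and>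
                     0 \<le> laplacian v0 x + exp (u0 x)) \<and>
     (\<forall>x\<in>cball (0::'a) R. 0 \<le> deriv (radial_profile u0) (norm x) \<and>
                            0 \<le> deriv (radial_profile v0) (norm x))"

text \<open>Classical solutions on \<open>[0,T)\<close>: \<open>C\<^sup>2\<^sup>,\<^sup>1\<close> in the open cylinder, continuous up to the
  lateral boundary and up to \<open>t = 0\<close>, with the normal derivatives existing on the lateral
  boundary.\<close>

definition classical_solution ::
    "real \<Rightarrow> real \<Rightarrow> real \<Rightarrow> ('a::euclidean_space \<Rightarrow> real) \<Rightarrow> ('a \<Rightarrow> real) \<Rightarrow> real \<Rightarrow>
     ('a \<Rightarrow> real \<Rightarrow> real) \<Rightarrow> ('a \<Rightarrow> real \<Rightarrow> real) \<Rightarrow> bool" where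
  "classical_solution l1 l2 R u0 v0 T u v \<longleftrightarrow>
     0 < T \<and>
     continuous_on (cball 0 R \<times> {0..<T}) (\<lambda>(x, t). u x t) \<and>
     continuous_on (cball 0 R \<times> {0..<T}) (\<lambda>(x, t). v x t) \<and>
     C21_on (ball 0 R) T u \<and> C21_on (ball 0 R) T v \<and>
     (\<forall>t\<in>{0..<T}. radial_on (cball 0 R) (\<lambda>x. u x t) \<and> radial_on (cball 0 R) (\<lambda>x. v x t)) \<and>
     (\<forall>x\<in>ball 0 R. \<forall>t\<in>{0<..<T}.
        deriv (u x) t = laplacian (\<lambda>y. u y t) x + l1 * exp (v x t) \<and>
        deriv (v x) t = laplacian (\<lambda>y. v y t) x + l2 * exp (u x t)) \<and>
     (\<forall>x\<in>sphere 0 R. \<forall>t\<in>{0<..<T}.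
        has_normal_derivative R (\<lambda>y. u y t) (exp (v x t)) x \<and>
        has_normal_derivative R (\<lambda>y. v y t) (exp (u x t)) x) \<and>
     (\<forall>x\<in>ball 0 R. u x 0 = u0 x \<and> v x 0 = v0 x)"

text \<open>The third condition says that the limes superior of the sup norm of \<open>(u, v)\<close> as \<open>t\<close>
  increases to \<open>T\<close> is infinite.\<close>

definition blow_up_solution ::
    "real \<Rightarrow> real \<Rightarrow> real \<Rightarrow> ('a::euclidean_space \<Rightarrow> real) \<Rightarrow> ('a \<Rightarrow> real) \<Rightarrow> real \<Rightarrow>
     ('a \<Rightarrow> real \<Rightarrow> real) \<Rightarrow> ('a \<Rightarrow> real \<Rightarrow> real) \<Rightarrow> bool" where
  "blow_up_solution l1 l2 R u0 v0 T u v \<longleftrightarrow>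
     classical_solution l1 l2 R u0 v0 T u v \<and>
     (\<nexists>T' u' v'. T < T' \<and> classical_solution l1 l2 R u0 v0 T' u' v' \<and>
        (\<forall>x\<in>cball 0 R. \<forall>t\<in>{0..<T}. u' x t = u x t \<and> v' x t = v x t)) \<and>
     (\<forall>M. \<exists>\<^sub>F t in at_left T.
        M < sup_norm_on (ball 0 R) (\<lambda>x. u x t) + sup_norm_on (ball 0 R) (\<lambda>x. v x t))"

end

theory Submission
  imports Defs
begin

text \<open>The rate is a lower bound on the remaining life span.  The rescaling of the problem
  suggests that a solution whose components are at most \<open>M\<close> at time \<open>t\<^sub>0\<close> cannot become
  unbounded before time \<open>t\<^sub>0 + c * exp (- 2 * M)\<close>: the flux \<open>exp u\<close> is the dominant nonlinearity,
  it lives in a boundary layer of width \<open>exp (- M)\<close>, and heat crosses that layer in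
  time \<open>exp (- 2 * M)\<close>.  An explicit supersolution (\<open>barrier\<close>), a linear growth in time plus a
  boundary layer profile, makes this rigorous.  So blow-up at \<open>T\<close> forces \<open>T - t\<close> to be at least a
  constant times \<open>exp (- 2 * M)\<close>, where \<open>M\<close> bounds both components at time \<open>t\<close>
  (\<open>remaining_time\<close>).

  It remains to replace \<open>M\<close> by the boundary value of a single component, up to an additive
  constant.  Radial monotonicity of the data is preserved (\<open>radially_nondecreasing\<close>), so each
  component is largest on the boundary, and since both equations carry the same factor, the
  difference of the components stays bounded (\<open>difference_bounded\<close>): where \<open>u\<close> exceeds \<open>v\<close>,
  both the reaction terms and the fluxes act to shrink \<open>u - v\<close>.

  Every comparison is a first contact argument.  At the first time a quantity that starts negative
  reaches zero, it has a spatial maximum, and there the time derivative, the Laplacian and the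
  normal derivative have known signs; the equation or the boundary condition contradicts
  them.  This needs pointwise derivatives only, hence no regularity of the gradient at the
  boundary or at time zero.  For the same reason radial monotonicity is not derived from an equation
  for the radial derivative: the contact argument is applied to \<open>u x t - u y t\<close> on all pairs of
  points with \<open>norm x \<le> norm y\<close>.\<close>

section \<open>Derivatives at a maximum\<close>

lemma left_derivative_nonneg_at_max:
  fixes h :: "real \<Rightarrow> real"
  assumes "(h has_real_derivative D) (at t within {..t})" and "a < t"
    and "\<And>s. a \<le> s \<Longrightarrow> s < t \<Longrightarrow> h s \<le> h t"
  shows "0 \<le> D"
proof (rule ccontr)
  assume "\<not> 0 \<le> D"
  then obtain d where d: "d > 0" "\<And>e. e > 0 \<Longrightarrow> t - e \<in> {..t} \<Longrightarrow> e < d \<Longrightarrow> h t < h (t - e)"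
    using has_real_derivative_neg_dec_left[OF assms(1)] by auto
  define e where "e = min (d / 2) (t - a)"
  have "e > 0" "e < d" "a \<le> t - e" using d assms(2) by (auto simp: e_def)
  then show False using d(2)[of e] assms(3)[of "t - e"] by auto
qed

lemma second_derivative_nonpos_at_max:
  fixes g g' :: "real \<Rightarrow> real"
  assumes "0 < d" and g: "\<And>s. \<bar>s\<bar> < d \<Longrightarrow> (g has_real_derivative g' s) (at s)"
    and g': "(g' has_real_derivative c) (at 0)"
    and max: "\<And>s. \<bar>s\<bar> < d \<Longrightarrow> g s \<le> g 0"
  shows "c \<le> 0"
proof (rule ccontr)
  assume "\<not> c \<le> 0"
  then obtain e where e: "e > 0" "\<And>h. h > 0 \<Longrightarrow> h < e \<Longrightarrow> g' 0 < g' h"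
    using has_real_derivative_pos_inc_right[OF g'] by auto
  have 0: "g' 0 = 0"
    using DERIV_local_max[OF g[of 0] \<open>0 < d\<close>] max \<open>0 < d\<close> by auto
  define m where "m = min d e / 2"
  have m: "0 < m" "m < d" "m < e" using e(1) \<open>0 < d\<close> by (auto simp: m_def)
  obtain z where z: "0 < z" "z < m" "g m - g 0 = (m - 0) * g' z"
    using MVT2[OF m(1), of g g'] g m(2) by auto
  have "0 < m * g' z" using z m e(2)[of z] 0 by auto
  then show False using z(3) max[of m] m by auto
qed

text \<open>The pointwise regularity under which \<open>laplacian f\<close> is a genuine sum of second
  derivatives.\<close>

definition twice_partial_on :: "'a::euclidean_space set \<Rightarrow> ('a \<Rightarrow> real) \<Rightarrow> bool" where
  "twice_partial_on S f \<longleftrightarrow>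
     (\<forall>i\<in>Basis. \<forall>x\<in>S. has_partial i f x \<and> has_partial i (partial i f) x)"

lemma has_partialD:
  assumes "has_partial i f (x + s *\<^sub>R i)"
  shows "((\<lambda>s. f (x + s *\<^sub>R i)) has_real_derivative partial i f (x + s *\<^sub>R i)) (at s)"
proof -
  have "((\<lambda>r. f ((x + s *\<^sub>R i) + r *\<^sub>R i)) has_real_derivative partial i f (x + s *\<^sub>R i)) (at 0)"
    using assms unfolding has_partial_def partial_def
    by (simp add: DERIV_deriv_iff_real_differentiable)
  then show ?thesis
    using DERIV_shift[of "\<lambda>s. f (x + s *\<^sub>R i)" "partial i f (x + s *\<^sub>R i)" 0 s]
    by (simp add: algebra_simps)
qed

lemma has_partialI:
  assumes "((\<lambda>s. f (x + s *\<^sub>R i)) has_real_derivative D) (at 0)"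
  shows "has_partial i f x" and "partial i f x = D"
  using assms unfolding has_partial_def partial_def
  by (auto simp: real_differentiable_def DERIV_imp_deriv)

text \<open>The second derivative test along each coordinate line.  Stating it for a difference of two
  functions covers comparison with a second solution, with a barrier and, with a constant, a
  plain maximum or minimum.\<close>

lemma laplacian_le_at_max:
  fixes f g :: "'a::euclidean_space \<Rightarrow> real"
  assumes f: "twice_partial_on S f" and g: "twice_partial_on S g"
    and "open S" "x \<in> S"
    and max: "\<And>y. y \<in> S \<Longrightarrow> f y - g y \<le> f x - g x"
  shows "laplacian f x \<le> laplacian g x"
  unfolding laplacian_def
proof (rule sum_mono)
  fix i :: 'a assume i: "i \<in> Basis"
  obtain d where d: "d > 0" "ball x d \<subseteq> S"
    using \<open>open S\<close> \<open>x \<in> S\<close> open_contains_ball by blast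
  have S: "x + s *\<^sub>R i \<in> S" if "\<bar>s\<bar> < d" for s
    using that d i by (auto simp: subset_iff dist_norm)
  have "partial i (partial i f) x - partial i (partial i g) x \<le> 0"
  proof (rule second_derivative_nonpos_at_max[OF d(1)])
    show "((\<lambda>s. f (x + s *\<^sub>R i) - g (x + s *\<^sub>R i)) has_real_derivative
            partial i f (x + s *\<^sub>R i) - partial i g (x + s *\<^sub>R i)) (at s)" if "\<bar>s\<bar> < d" for s
      using f g i S[OF that] by (intro DERIV_diff has_partialD) (auto simp: twice_partial_on_def)
    show "((\<lambda>s. partial i f (x + s *\<^sub>R i) - partial i g (x + s *\<^sub>R i)) has_real_derivative
            partial i (partial i f) x - partial i (partial i g) x) (at 0)"
      using f g i \<open>x \<in> S\<close> has_partialD[of i "partial i f" x 0] has_partialD[of i "partial i g" x 0]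
      by (intro DERIV_diff) (auto simp: twice_partial_on_def)
    show "f (x + s *\<^sub>R i) - g (x + s *\<^sub>R i) \<le> f (x + 0 *\<^sub>R i) - g (x + 0 *\<^sub>R i)" if "\<bar>s\<bar> < d" for s
      using max[OF S[OF that]] by simp
  qed
  then show "partial i (partial i f) x \<le> partial i (partial i g) x" by simp
qed

lemma const_twice_partial:
  shows "twice_partial_on S (\<lambda>x. c)" and "laplacian (\<lambda>x. c) x = 0"
  by (auto simp: twice_partial_on_def laplacian_def has_partial_def partial_def)

text \<open>From a boundary maximum of \<open>f - g\<close> the difference can only drop when one moves inwards along
  the normal.\<close>

lemma normal_derivative_le_at_max:
  fixes f g :: "'a::euclidean_space \<Rightarrow> real"
  assumes "0 < R" and x: "x \<in> sphere 0 R"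
    and f: "has_normal_derivative R f a x" and g: "has_normal_derivative R g b x"
    and "0 < d" and max: "\<And>y. y \<in> ball x d \<Longrightarrow> y \<in> cball 0 R \<Longrightarrow> f y - g y \<le> f x - g x"
  shows "b \<le> a"
proof -
  let ?p = "\<lambda>s. x + s *\<^sub>R (x /\<^sub>R R)"
  have nx: "norm x = R" using x by simp
  have "((\<lambda>s. f (?p s) - g (?p s)) has_real_derivative a - b) (at 0 within {..0})"
    using f g unfolding has_normal_derivative_def by (rule DERIV_diff)
  moreover have "- min d R / 2 < 0" using \<open>0 < d\<close> \<open>0 < R\<close> by simp
  ultimately have "0 \<le> a - b"
  proof (rule left_derivative_nonneg_at_max)
    fix s :: real assume s: "- min d R / 2 \<le> s" "s < 0"
    have "?p s = (1 + s / R) *\<^sub>R x"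
      by (simp add: algebra_simps divide_inverse)
    moreover have "\<bar>1 + s / R\<bar> \<le> 1" using s \<open>0 < R\<close> by (auto simp: field_simps abs_le_iff)
    ultimately have "?p s \<in> cball 0 R"
      using nx \<open>0 < R\<close> by (simp add: mult_left_le_one_le)
    moreover have "norm (s *\<^sub>R (x /\<^sub>R R)) = \<bar>s\<bar>" using nx \<open>0 < R\<close> by (simp add: field_simps)
    then have "norm (s *\<^sub>R (x /\<^sub>R R)) < d" using s \<open>0 < d\<close> by auto
    then have "?p s \<in> ball x d" by (simp add: dist_norm)
    ultimately show "f (?p s) - g (?p s) \<le> f (?p 0) - g (?p 0)" using max by simp
  qed
  then show ?thesis by simp
qed

section \<open>First contact\<close>

text \<open>Among the points of the compact cylinder where \<open>f\<close> is nonnegative there is one with the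
  least time; the intermediate value theorem in time shows that \<open>f\<close> is exactly zero there and
  nonpositive elsewhere at that time.\<close>

lemma first_contact:
  fixes f :: "'b::metric_space \<Rightarrow> real \<Rightarrow> real"
  assumes "compact K" and cont: "continuous_on (K \<times> {a..b}) (\<lambda>(x, t). f x t)"
    and init: "\<And>x. x \<in> K \<Longrightarrow> f x a < 0"
    and contact: "x0 \<in> K" "t0 \<in> {a..b}" "0 \<le> f x0 t0"
  obtains x t where "x \<in> K" "a < t" "t \<le> b" "f x t = 0"
    "\<And>y s. y \<in> K \<Longrightarrow> s \<in> {a..t} \<Longrightarrow> f y s \<le> 0"
proof -
  let ?F = "\<lambda>(x, t). f x t"
  define S where "S = {p \<in> K \<times> {a..b}. 0 \<le> ?F p}"
  have comp: "compact (K \<times> {a..b})" using \<open>compact K\<close> by (intro compact_Times) auto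
  then have "closed (K \<times> {a..b})" by (rule compact_imp_closed)
  then have "closed S"
    unfolding S_def using continuous_closed_preimage[OF cont, of "{0..}"]
    by (simp add: vimage_def Int_def conj_commute split_beta)
  then have "compact S"
    using comp compact_Int_closed[of "K \<times> {a..b}" S] by (simp add: S_def Int_def)
  moreover have "S \<noteq> {}" using contact by (auto simp: S_def)
  ultimately obtain p where p: "p \<in> S" "\<And>q. q \<in> S \<Longrightarrow> snd p \<le> snd q"
    using continuous_attains_inf[of S snd] continuous_on_snd[OF continuous_on_id] by blast
  obtain x t where xt: "p = (x, t)" by (cases p)
  have x: "x \<in> K" "t \<in> {a..b}" "0 \<le> f x t" using p(1) xt by (auto simp: S_def)
  have neg: "f y s < 0" if "y \<in> K" "a \<le> s" "s < t" for y s
    using p(2)[of "(y, s)"] that x xt by (fastforce simp: S_def)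
  have "a < t" using init[OF x(1)] x by (cases "a = t") auto
  have le: "f y t \<le> 0" if y: "y \<in> K" for y
  proof (rule ccontr)
    assume pos: "\<not> f y t \<le> 0"
    have "continuous_on {a..t} (\<lambda>s. ?F (y, s))"
      using y x(2) by (intro continuous_on_compose2[OF cont] continuous_intros) auto
    then obtain s where s: "a \<le> s" "s \<le> t" "f y s = 0"
      using IVT'[of "f y" a 0 t] init[OF y] pos \<open>a < t\<close> by auto
    then show False using neg[OF y, of s] pos by (cases "s = t") auto
  qed
  show ?thesis
  proof (rule that[of x t])
    show "f y s \<le> 0" if "y \<in> K" "s \<in> {a..t}" for y s
      using neg[of y s] le[of y] that by (cases "s = t") auto
  qed (use x le[of x] \<open>a < t\<close> in auto)
qed

section \<open>The boundary layer profile\<close>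

lemma boundary_layer_partials:
  fixes x :: "'a::euclidean_space"
  defines "\<psi> \<equiv> \<lambda>k R c (x::'a). c + exp (k * (x \<bullet> x - R\<^sup>2))"
  shows "twice_partial_on S (\<psi> k R c)"
    and "laplacian (\<psi> k R c) x = (2 * k * DIM('a) + 4 * k\<^sup>2 * (x \<bullet> x)) * exp (k * (x \<bullet> x - R\<^sup>2))"
    and "0 < R \<Longrightarrow> x \<in> sphere 0 R \<Longrightarrow> has_normal_derivative R (\<psi> k R c) (2 * k * R) x"
proof -
  let ?e = "\<lambda>x. exp (k * (x \<bullet> x - R\<^sup>2))"
  have 1: "((\<lambda>s. \<psi> k R c (x + s *\<^sub>R i)) has_real_derivative 2 * k * (x \<bullet> i) * ?e x) (at 0)" for i x :: 'a
    unfolding \<psi>_def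
    by (auto intro!: derivative_eq_intros simp: inner_add_left inner_add_right inner_commute)
  have p1: "partial i (\<psi> k R c) = (\<lambda>x. 2 * k * (x \<bullet> i) * ?e x)" for i :: 'a
    using has_partialI(2)[OF 1] by blast
  have 2: "((\<lambda>s. partial i (\<psi> k R c) (x + s *\<^sub>R i)) has_real_derivative
      (2 * k + 4 * k\<^sup>2 * (x \<bullet> i)\<^sup>2) * ?e x) (at 0)" if "i \<in> Basis" for i x :: 'a
    unfolding p1 using that
    by (auto intro!: derivative_eq_intros
        simp: inner_add_left inner_add_right inner_commute algebra_simps power2_eq_square)
  show "twice_partial_on S (\<psi> k R c)"
    unfolding twice_partial_on_def using has_partialI(1)[OF 1] has_partialI(1)[OF 2] by blast
  have "laplacian (\<psi> k R c) x = (\<Sum>i\<in>Basis. (2 * k + 4 * k\<^sup>2 * (x \<bullet> i)\<^sup>2) * ?e x)"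
    unfolding laplacian_def by (intro sum.cong refl has_partialI(2)[OF 2])
  also have "\<dots> = (2 * k * DIM('a) + 4 * k\<^sup>2 * (\<Sum>i\<in>Basis. (x \<bullet> i)\<^sup>2)) * ?e x"
    by (simp add: sum_distrib_right[symmetric] sum.distrib sum_distrib_left algebra_simps)
  also have "(\<Sum>i\<in>Basis. (x \<bullet> i)\<^sup>2) = x \<bullet> x"
    by (simp add: euclidean_inner[of x x] power2_eq_square)
  finally show "laplacian (\<psi> k R c) x = (2 * k * DIM('a) + 4 * k\<^sup>2 * (x \<bullet> x)) * ?e x" .
  assume "0 < R" "x \<in> sphere 0 R"
  then have "x \<bullet> x = R\<^sup>2" by (simp add: dot_square_norm)
  then show "has_normal_derivative R (\<psi> k R c) (2 * k * R) x"
    unfolding has_normal_derivative_def \<psi>_def using \<open>0 < R\<close>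
    by (auto intro!: derivative_eq_intros
        simp: inner_add_left inner_add_right inner_commute field_simps power2_eq_square)
qed

section \<open>The parabolic system\<close>

text \<open>The assumptions are invariant under exchanging \<open>u\<close> and \<open>v\<close>; each comparison is proved for
  \<open>u\<close> and transferred to \<open>v\<close> by \<open>swapped\<close>.\<close>

locale heat_system =
  fixes R lam T :: real and u v :: "'a::euclidean_space \<Rightarrow> real \<Rightarrow> real"
  assumes R: "0 < R" and lam: "0 < lam"
    and cont_u: "continuous_on (cball 0 R \<times> {0..<T}) (\<lambda>(x, t). u x t)"
    and cont_v: "continuous_on (cball 0 R \<times> {0..<T}) (\<lambda>(x, t). v x t)"
    and smooth_u: "\<And>t. t \<in> {0<..<T} \<Longrightarrow> twice_partial_on (ball 0 R) (\<lambda>y. u y t)"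
    and smooth_v: "\<And>t. t \<in> {0<..<T} \<Longrightarrow> twice_partial_on (ball 0 R) (\<lambda>y. v y t)"
    and heat_u: "\<And>x t. x \<in> ball 0 R \<Longrightarrow> t \<in> {0<..<T} \<Longrightarrow>
      (u x has_real_derivative laplacian (\<lambda>y. u y t) x + lam * exp (v x t)) (at t)"
    and heat_v: "\<And>x t. x \<in> ball 0 R \<Longrightarrow> t \<in> {0<..<T} \<Longrightarrow>
      (v x has_real_derivative laplacian (\<lambda>y. v y t) x + lam * exp (u x t)) (at t)"
    and flux_u: "\<And>x t. x \<in> sphere 0 R \<Longrightarrow> t \<in> {0<..<T} \<Longrightarrow>
      has_normal_derivative R (\<lambda>y. u y t) (exp (v x t)) x"
    and flux_v: "\<And>x t. x \<in> sphere 0 R \<Longrightarrow> t \<in> {0<..<T} \<Longrightarrow>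
      has_normal_derivative R (\<lambda>y. v y t) (exp (u x t)) x"
    and radial_u: "\<And>x y t. x \<in> cball 0 R \<Longrightarrow> y \<in> cball 0 R \<Longrightarrow> norm x = norm y \<Longrightarrow>
      t \<in> {0..<T} \<Longrightarrow> u x t = u y t"
    and radial_v: "\<And>x y t. x \<in> cball 0 R \<Longrightarrow> y \<in> cball 0 R \<Longrightarrow> norm x = norm y \<Longrightarrow>
      t \<in> {0..<T} \<Longrightarrow> v x t = v y t"
    and init_u: "\<And>x. x \<in> cball 0 R \<Longrightarrow> 0 \<le> u x 0"
    and init_v: "\<And>x. x \<in> cball 0 R \<Longrightarrow> 0 \<le> v x 0"
    and init_mono_u: "\<And>x y. x \<in> cball 0 R \<Longrightarrow> y \<in> cball 0 R \<Longrightarrow> norm x \<le> norm y \<Longrightarrow> u x 0 \<le> u y 0"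
    and init_mono_v: "\<And>x y. x \<in> cball 0 R \<Longrightarrow> y \<in> cball 0 R \<Longrightarrow> norm x \<le> norm y \<Longrightarrow> v x 0 \<le> v y 0"
begin

lemma swapped: "heat_system R lam T v u"
  by (rule heat_system.intro[OF R lam cont_v cont_u smooth_v smooth_u heat_v heat_u flux_v flux_u
        radial_v radial_u init_v init_u init_mono_v init_mono_u])

lemma continuous_on_compact:
  assumes "b < T" "0 \<le> a"
  shows "continuous_on (cball 0 R \<times> {a..b}) (\<lambda>(x, t). u x t)"
    and "continuous_on (cball 0 R \<times> {a..b}) (\<lambda>(x, t). v x t)"
proof -
  have "cball (0::'a) R \<times> {a..b} \<subseteq> cball 0 R \<times> {0..<T}" using assms by auto
  then show "continuous_on (cball 0 R \<times> {a..b}) (\<lambda>(x, t). u x t)"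
    and "continuous_on (cball 0 R \<times> {a..b}) (\<lambda>(x, t). v x t)"
    using continuous_on_subset[OF cont_u] continuous_on_subset[OF cont_v] by blast+
qed

lemma bounded_above:
  assumes "b < T"
  obtains B where "\<And>x t. x \<in> cball 0 R \<Longrightarrow> t \<in> {0..b} \<Longrightarrow> u x t \<le> B \<and> v x t \<le> B"
proof -
  have comp: "compact (cball (0::'a) R \<times> {0..b})" by (intro compact_Times) auto
  have "bdd_above ((\<lambda>(x, t). u x t) ` (cball 0 R \<times> {0..b}))"
    "bdd_above ((\<lambda>(x, t). v x t) ` (cball 0 R \<times> {0..b}))"
    using continuous_on_compact[OF assms, of 0] comp
    by (auto intro!: bounded_imp_bdd_above compact_imp_bounded compact_continuous_image)
  then obtain B1 B2 where "\<And>x t. x \<in> cball 0 R \<Longrightarrow> t \<in> {0..b} \<Longrightarrow> u x t \<le> B1"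
      and "\<And>x t. x \<in> cball 0 R \<Longrightarrow> t \<in> {0..b} \<Longrightarrow> v x t \<le> B2"
    unfolding bdd_above_def by fast
  then show ?thesis using that[of "max B1 B2"] by (meson le_max_iff_disj)
qed

text \<open>With zero as comparison function, a new minimum of \<open>u\<close> is impossible, because the source
  and the flux are strictly positive.  The level \<open>-1\<close> makes the initial inequality strict.\<close>

lemma above_minus_one:
  assumes "x \<in> cball 0 R" "t \<in> {0..<T}"
  shows "-1 < u x t"
proof (rule ccontr)
  assume "\<not> -1 < u x t"
  then have touch: "0 \<le> -1 - u x t" by simp
  have cont: "continuous_on (cball 0 R \<times> {0..t}) (\<lambda>(x, t). -1 - u x t)"
    using continuous_on_compact(1)[of t 0] assms
    by (auto simp: split_beta intro!: continuous_intros)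
  have init: "-1 - u z 0 < 0" if "z \<in> cball 0 R" for z using init_u[OF that] by simp
  have "t \<in> {0..t}" using assms by simp
  then obtain y s where y: "y \<in> cball 0 R" "0 < s" "s \<le> t" "-1 - u y s = 0"
    and le: "\<And>z r. z \<in> cball 0 R \<Longrightarrow> r \<in> {0..s} \<Longrightarrow> -1 - u z r \<le> 0"
    using first_contact[OF compact_cball cont init assms(1) _ touch] by metis
  have s: "s \<in> {0<..<T}" using y assms by auto
  show False
  proof (cases "y \<in> ball 0 R")
    case True
    have "laplacian (\<lambda>z. 0) y \<le> laplacian (\<lambda>z. u z s) y"
      using le[of _ s] y
      by (intro laplacian_le_at_max[OF const_twice_partial(1) smooth_u[OF s] open_ball True]) auto
    moreover have "0 \<le> - (laplacian (\<lambda>z. u z s) y + lam * exp (v y s))"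
    proof (rule left_derivative_nonneg_at_max[OF _ y(2)])
      show "((\<lambda>r. - u y r) has_real_derivative - (laplacian (\<lambda>z. u z s) y + lam * exp (v y s)))
          (at s within {..s})"
        by (intro DERIV_minus has_field_derivative_at_within[OF heat_u[OF True s]])
    qed (use le y in fastforce)
    ultimately show False
      using lam mult_pos_pos[OF lam exp_gt_zero[of "v y s"]]
      by (simp only: const_twice_partial(2))
  next
    case False
    then have sph: "y \<in> sphere 0 R" using y by auto
    have "exp (v y s) \<le> 0"
    proof (rule normal_derivative_le_at_max[OF R sph _ flux_u[OF sph s], of "\<lambda>_. 0" 0 1])
      show "0 - u z s \<le> 0 - u y s" if "z \<in> cball 0 R" for z
        using le[OF that, of s] y by auto
    qed (auto simp: has_normal_derivative_def)
    then show False by simp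
  qed
qed

text \<open>At a first contact \<open>u\<close> exceeds \<open>v\<close> by \<open>K > 0\<close>.  Inside, the equations would give
  \<open>exp (u y s) \<le> exp (v y s)\<close>; on the boundary, the fluxes would.\<close>

lemma difference_bounded:
  assumes K: "0 < K" "\<And>x. x \<in> cball 0 R \<Longrightarrow> u x 0 - v x 0 < K"
    and "x \<in> cball 0 R" "t \<in> {0..<T}"
  shows "u x t - v x t < K"
proof (rule ccontr)
  assume "\<not> u x t - v x t < K"
  then have touch: "0 \<le> u x t - v x t - K" by simp
  have cont: "continuous_on (cball 0 R \<times> {0..t}) (\<lambda>(x, t). u x t - v x t - K)"
    using continuous_on_compact[of t 0] assms
    by (auto simp: split_beta intro!: continuous_intros)
  have init: "u z 0 - v z 0 - K < 0" if "z \<in> cball 0 R" for z using K(2)[OF that] by simp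
  have "t \<in> {0..t}" using assms by simp
  then obtain y s where y: "y \<in> cball 0 R" "0 < s" "s \<le> t" "u y s - v y s - K = 0"
    and le: "\<And>z r. z \<in> cball 0 R \<Longrightarrow> r \<in> {0..s} \<Longrightarrow> u z r - v z r - K \<le> 0"
    using first_contact[OF compact_cball cont init assms(3) _ touch] by metis
  have s: "s \<in> {0<..<T}" using y assms by auto
  have max: "u z s - v z s \<le> u y s - v y s" if "z \<in> cball 0 R" for z
    using le[OF that, of s] y by auto
  show False
  proof (cases "y \<in> ball 0 R")
    case True
    have "laplacian (\<lambda>z. u z s) y \<le> laplacian (\<lambda>z. v z s) y"
      using max by (intro laplacian_le_at_max[OF smooth_u[OF s] smooth_v[OF s] open_ball True]) auto
    moreover have "0 \<le> (laplacian (\<lambda>z. u z s) y + lam * exp (v y s))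
        - (laplacian (\<lambda>z. v z s) y + lam * exp (u y s))"
    proof (rule left_derivative_nonneg_at_max[OF _ y(2)])
      show "((\<lambda>r. u y r - v y r) has_real_derivative (laplacian (\<lambda>z. u z s) y + lam * exp (v y s))
        - (laplacian (\<lambda>z. v z s) y + lam * exp (u y s))) (at s within {..s})"
        by (intro DERIV_diff has_field_derivative_at_within[OF heat_u[OF True s]]
            has_field_derivative_at_within[OF heat_v[OF True s]])
    qed (use le y in fastforce)
    ultimately have "lam * exp (u y s) \<le> lam * exp (v y s)" by simp
    then have "u y s \<le> v y s" using lam by simp
    then show False using y K by simp
  next
    case False
    then have sph: "y \<in> sphere 0 R" using y by auto
    have "exp (u y s) \<le> exp (v y s)"
      using max
      by (intro normal_derivative_le_at_max[OF R sph flux_u[OF sph s] flux_v[OF sph s] zero_less_one]) auto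
    then show False using y K by simp
  qed
qed

section \<open>Preservation of radial monotonicity\<close>

text \<open>The contact step for the doubled function \<open>u x t - u y t\<close> against the majorant
  \<open>E * exp (L * (s - t))\<close>.  By radiality the contact value \<open>E > 0\<close> forces \<open>norm x < norm y\<close>, so the
  constraint is inactive: \<open>x\<close> is a local maximum and \<open>y\<close> a local minimum of \<open>u\<close> at time \<open>t\<close>.  The
  positive flux keeps \<open>y\<close> off the boundary, both Laplacians have the favourable sign, and the
  reaction difference is at most \<open>lam * exp B * E\<close>, so the majorant cannot have a larger relative
  growth rate than \<open>lam * exp B\<close>.\<close>

lemma pair_contact_rate:
  assumes x: "x \<in> cball 0 R" and y: "y \<in> cball 0 R" and xy: "norm x \<le> norm y"
    and t: "t \<in> {0<..<T}" and "0 < E"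
    and contact: "u x t - u y t = E" and v: "v x t - v y t \<le> E"
    and max: "\<And>x' y'. x' \<in> cball 0 R \<Longrightarrow> y' \<in> cball 0 R \<Longrightarrow> norm x' \<le> norm y' \<Longrightarrow> u x' t - u y' t \<le> E"
    and past: "\<And>s. s \<in> {0..t} \<Longrightarrow> u x s - u y s \<le> E * exp (L * (s - t))"
    and B: "v x t \<le> B"
  shows "L \<le> lam * exp B"
proof -
  have "norm x \<noteq> norm y" using radial_u[OF x y] contact \<open>0 < E\<close> t by auto
  then have less: "norm x < norm y" using xy by simp
  then have xb: "x \<in> ball 0 R" using y by auto
  \<comment> \<open>the ball around \<open>y\<close> is small enough to stay outside the sphere through \<open>x\<close>\<close>
  have y_min: "u y t \<le> u z t" if "z \<in> ball y (norm y - norm x)" "z \<in> cball 0 R" for z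
  proof -
    have "norm x \<le> norm z"
      using that norm_triangle_ineq2[of y z] by (simp add: dist_norm)
    then show ?thesis using max[OF x that(2)] contact by auto
  qed
  have yb: "y \<in> ball 0 R"
  proof (rule ccontr)
    assume "y \<notin> ball 0 R"
    then have sph: "y \<in> sphere 0 R" using y by auto
    have "exp (v y t) \<le> 0"
    proof (rule normal_derivative_le_at_max[OF R sph _ flux_u[OF sph t], of "\<lambda>_. 0" 0 "norm y - norm x"])
      show "0 - u z t \<le> 0 - u y t" if "z \<in> ball y (norm y - norm x)" "z \<in> cball 0 R" for z
        using y_min[OF that] by simp
    qed (use less in \<open>auto simp: has_normal_derivative_def\<close>)
    then show False by simp
  qed
  have "laplacian (\<lambda>z. u z t) x \<le> laplacian (\<lambda>z. 0) x"
  proof (rule laplacian_le_at_max[OF _ const_twice_partial(1)])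
    show "twice_partial_on (ball 0 (norm y)) (\<lambda>z. u z t)"
      using smooth_u[OF t] y by (auto simp: twice_partial_on_def)
    show "u z t - 0 \<le> u x t - 0" if "z \<in> ball 0 (norm y)" for z
      using max[of z y] that y contact by auto
  qed (use less in auto)
  then have lx: "laplacian (\<lambda>z. u z t) x \<le> 0" by (simp only: const_twice_partial(2))
  have "laplacian (\<lambda>z. 0) y \<le> laplacian (\<lambda>z. u z t) y"
  proof (rule laplacian_le_at_max[OF const_twice_partial(1)])
    show "twice_partial_on (ball 0 R \<inter> ball y (norm y - norm x)) (\<lambda>z. u z t)"
      using smooth_u[OF t] by (auto simp: twice_partial_on_def)
    show "0 - u z t \<le> 0 - u y t" if "z \<in> ball 0 R \<inter> ball y (norm y - norm x)" for z
      using y_min[of z] that by auto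
  qed (use less yb in auto)
  then have ly: "0 \<le> laplacian (\<lambda>z. u z t) y" by (simp only: const_twice_partial(2))
  have "0 \<le> (laplacian (\<lambda>z. u z t) x + lam * exp (v x t))
      - (laplacian (\<lambda>z. u z t) y + lam * exp (v y t)) - E * L"
  proof (rule left_derivative_nonneg_at_max[of "\<lambda>s. u x s - u y s - E * exp (L * (s - t))" _ t 0])
    show "((\<lambda>s. u x s - u y s - E * exp (L * (s - t))) has_real_derivative
        (laplacian (\<lambda>z. u z t) x + lam * exp (v x t))
        - (laplacian (\<lambda>z. u z t) y + lam * exp (v y t)) - E * L) (at t within {..t})"
      by (intro DERIV_diff has_field_derivative_at_within[OF heat_u[OF xb t]]
            has_field_derivative_at_within[OF heat_u[OF yb t]])
         (auto intro!: derivative_eq_intros)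
    show "u x s - u y s - E * exp (L * (s - t)) \<le> u x t - u y t - E * exp (L * (t - t))"
      if "0 \<le> s" "s < t" for s
      using past[of s] that contact by simp
  qed (use t in auto)
  then have "E * L \<le> lam * (exp (v x t) - exp (v y t))" using lx ly by (simp add: algebra_simps)
  \<comment> \<open>convexity of the exponential: the tangent at \<open>v x t\<close> lies below the graph\<close>
  also have "exp (v x t) - exp (v y t) \<le> exp (v x t) * E"
  proof -
    have "1 - E \<le> exp (- E)" using exp_ge_add_one_self[of "- E"] by simp
    also have "\<dots> \<le> exp (v y t - v x t)" using v by simp
    finally have "exp (v x t) * (1 - E) \<le> exp (v x t) * exp (v y t - v x t)" by simp
    then show ?thesis by (simp add: exp_diff algebra_simps)
  qed
  also have "exp (v x t) * E \<le> exp B * E" using B \<open>0 < E\<close> by simp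
  finally have "E * L \<le> E * (lam * exp B)" using lam by (simp add: mult_ac)
  then show ?thesis using \<open>0 < E\<close> by simp
qed

text \<open>The two components are treated together since the reaction for one is controlled by the
  difference in the other.  The majorant grows at a rate above the Lipschitz constant, which
  contradicts \<open>pair_contact_rate\<close>.\<close>

lemma radially_nondecreasing_both:
  assumes x: "x \<in> cball 0 R" and y: "y \<in> cball 0 R" and xy: "norm x \<le> norm y"
    and t: "t \<in> {0..<T}"
  shows "max (u x t - u y t) (v x t - v y t) \<le> 0"
proof (rule ccontr)
  assume pos: "\<not> ?thesis"
  obtain B where B: "\<And>x s. x \<in> cball 0 R \<Longrightarrow> s \<in> {0..t} \<Longrightarrow> u x s \<le> B \<and> v x s \<le> B"
    using bounded_above[of t] t by auto
  define L where "L = lam * exp B + 1"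
  \<comment> \<open>chosen so that the majorant passes through the assumed violation at time \<open>t\<close>\<close>
  define \<epsilon> where "\<epsilon> = max (u x t - u y t) (v x t - v y t) / exp (L * t)"
  have "0 < \<epsilon>" unfolding \<epsilon>_def using pos by (intro divide_pos_pos) (auto simp: not_le)
  define K where "K = (cball 0 R \<times> cball 0 R) \<inter> {p::'a \<times> 'a. norm (fst p) \<le> norm (snd p)}"
  define f where "f p s = max (u (fst p) s - u (snd p) s) (v (fst p) s - v (snd p) s)
      - \<epsilon> * exp (L * s)" for p s
  have "closed {p::'a \<times> 'a. norm (fst p) \<le> norm (snd p)}"
    by (intro closed_Collect_le continuous_intros)
  then have "compact K"
    unfolding K_def by (intro compact_Int_closed compact_Times compact_cball)
  moreover have "continuous_on (K \<times> {0..t}) (\<lambda>(p, s). f p s)"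
  proof -
    have g: "continuous_on (K \<times> {0..t}) (\<lambda>q. (g (fst q), snd q))"
      "(\<lambda>q. (g (fst q), snd q)) ` (K \<times> {0..t}) \<subseteq> cball 0 R \<times> {0..t}" if "g = fst \<or> g = snd" for g
      using that by (elim disjE; force simp: K_def intro!: continuous_intros)+
    have u: "continuous_on (K \<times> {0..t}) (\<lambda>q. u (g (fst q)) (snd q))"
      and v: "continuous_on (K \<times> {0..t}) (\<lambda>q. v (g (fst q)) (snd q))" if "g = fst \<or> g = snd" for g
      using continuous_on_compose2[OF continuous_on_compact(1)[of t 0] g[OF that]]
        continuous_on_compose2[OF continuous_on_compact(2)[of t 0] g[OF that]] t by simp_all
    show ?thesis
      unfolding f_def split_beta
      using u[of fst] u[of snd] v[of fst] v[of snd]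
      by (auto intro!: continuous_intros)
  qed
  moreover have "f p 0 < 0" if "p \<in> K" for p
    using that init_mono_u[of "fst p" "snd p"] init_mono_v[of "fst p" "snd p"] \<open>0 < \<epsilon>\<close>
    by (auto simp: f_def K_def)
  moreover have "(x, y) \<in> K" "t \<in> {0..t}" "0 \<le> f (x, y) t"
    using x y xy t by (auto simp: K_def f_def \<epsilon>_def)
  ultimately obtain p s where p: "p \<in> K" "0 < s" "s \<le> t" "f p s = 0"
    and le: "\<And>q r. q \<in> K \<Longrightarrow> r \<in> {0..s} \<Longrightarrow> f q r \<le> 0"
    using first_contact[of K 0 t f] by metis
  obtain a b where ab: "p = (a, b)" by (cases p)
  define E where "E = \<epsilon> * exp (L * s)"
  have "0 < E" using \<open>0 < \<epsilon>\<close> by (simp add: E_def)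
  have s: "s \<in> {0<..<T}" using p t by auto
  have E: "\<epsilon> * exp (L * r) = E * exp (L * (r - s))" for r
    by (simp add: E_def exp_diff right_diff_distrib)
  have abK: "a \<in> cball 0 R" "b \<in> cball 0 R" "norm a \<le> norm b" using p ab by (auto simp: K_def)
  have bound: "u x' r - u y' r \<le> E * exp (L * (r - s))" "v x' r - v y' r \<le> E * exp (L * (r - s))"
    if "x' \<in> cball 0 R" "y' \<in> cball 0 R" "norm x' \<le> norm y'" "r \<in> {0..s}" for x' y' r
    using le[of "(x', y')" r] that by (auto simp: K_def f_def E)
  have bound_s: "u x' s - u y' s \<le> E" "v x' s - v y' s \<le> E"
    if "x' \<in> cball 0 R" "y' \<in> cball 0 R" "norm x' \<le> norm y'" for x' y'
    using bound[OF that, of s] p by auto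
  interpret sw: heat_system R lam T v u by (rule swapped)
  have aB: "u a s \<le> B" "v a s \<le> B" using B[OF abK(1), of s] p by auto
  have "max (u a s - u b s) (v a s - v b s) = E" using p(4) by (simp add: f_def ab E_def)
  then consider "u a s - u b s = E" | "v a s - v b s = E" by linarith
  then have "L \<le> lam * exp B"
  proof cases
    case 1
    show ?thesis
      by (rule pair_contact_rate[OF abK s \<open>0 < E\<close> 1 bound_s(2)[OF abK] bound_s(1)
            bound(1)[OF abK] \<open>v a s \<le> B\<close>])
  next
    case 2
    show ?thesis
      by (rule sw.pair_contact_rate[OF abK s \<open>0 < E\<close> 2 bound_s(1)[OF abK] bound_s(2)
            bound(2)[OF abK] \<open>u a s \<le> B\<close>])
  qed
  then show False by (simp add: L_def)
qed

lemma radially_nondecreasing: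
  assumes "x \<in> cball 0 R" "y \<in> cball 0 R" "norm x \<le> norm y" "t \<in> {0..<T}"
  shows "u x t \<le> u y t" and "v x t \<le> v y t"
  using radially_nondecreasing_both[OF assms] by auto

section \<open>The barrier and the remaining life span\<close>

text \<open>The summands dominate, in units of \<open>exp (2 * M)\<close>, the two parts of the Laplacian of the
  boundary layer and the reaction term at height \<open>M + 2\<close>; the summand \<open>1\<close> makes the
  supersolution inequality strict.\<close>

definition growth_const :: real where
  "growth_const = 1 + exp 3 * DIM('a) / R + exp 6 + lam * exp 2"

text \<open>Both the linear part and the boundary layer contribute at most \<open>1\<close> during the life span
  considered, so the barrier stays below \<open>M + 2\<close>.  The steepness is chosen to give the normal
  derivative \<open>exp (M + 3)\<close> on the sphere, more than the flux \<open>exp (M + 2)\<close> allowed at that height.\<close>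

definition barrier :: "real \<Rightarrow> real \<Rightarrow> 'a \<Rightarrow> real \<Rightarrow> real" where
  "barrier M t0 x t = M + growth_const * exp (2 * M) * (t - t0)
     + exp (exp (M + 3) / (2 * R) * (x \<bullet> x - R\<^sup>2))"

lemma growth_const_pos: "0 < growth_const"
  using R lam by (auto simp: growth_const_def intro!: add_pos_nonneg)

lemma barrier_le:
  assumes "x \<in> cball 0 R" "growth_const * exp (2 * M) * (t - t0) \<le> 1"
  shows "barrier M t0 x t \<le> M + 2"
proof -
  have "x \<bullet> x \<le> R\<^sup>2" using assms(1) R by (simp add: dot_square_norm power_mono)
  then have "exp (M + 3) / (2 * R) * (x \<bullet> x - R\<^sup>2) \<le> 0"
    using R by (intro mult_nonneg_nonpos) auto
  then have "exp (exp (M + 3) / (2 * R) * (x \<bullet> x - R\<^sup>2)) \<le> 1" by simp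
  then show ?thesis unfolding barrier_def using assms(2) by linarith
qed

text \<open>The strict supersolution property: a touching solution would have a time derivative, or a
  flux, at least as large as that of the barrier.\<close>

lemma barrier_not_touched:
  assumes "0 \<le> M" and x: "x \<in> cball 0 R" and t: "t \<in> {0<..<T}" and "t0 < t"
    and life: "growth_const * exp (2 * M) * (t - t0) \<le> 1"
    and contact: "u x t = barrier M t0 x t" and v: "v x t \<le> barrier M t0 x t"
    and below: "\<And>y s. y \<in> cball 0 R \<Longrightarrow> s \<in> {t0..t} \<Longrightarrow> u y s \<le> barrier M t0 y s"
  shows False
proof -
  define k where "k = exp (M + 3) / (2 * R)"
  define c where "c = M + growth_const * exp (2 * M) * (t - t0)"
  have k: "0 < k" "2 * k * R = exp (M + 3)" using R by (auto simp: k_def)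
  have b: "(\<lambda>y. barrier M t0 y t) = (\<lambda>y. c + exp (k * (y \<bullet> y - R\<^sup>2)))"
    by (simp add: barrier_def k_def c_def)
  have smooth: "twice_partial_on S (\<lambda>y. barrier M t0 y t)" for S
    unfolding b by (rule boundary_layer_partials(1))
  have v2: "exp (v x t) \<le> exp (M + 2)" using v barrier_le[OF x life] by simp
  have max: "u y t - barrier M t0 y t \<le> u x t - barrier M t0 x t" if "y \<in> cball 0 R" for y
    using below[OF that, of t] contact \<open>t0 < t\<close> by simp
  show False
  proof (cases "x \<in> ball 0 R")
    case True
    have xR: "x \<bullet> x \<le> R\<^sup>2" using x R by (simp add: dot_square_norm power_mono)
    have "laplacian (\<lambda>y. u y t) x \<le> laplacian (\<lambda>y. barrier M t0 y t) x"
      using max by (intro laplacian_le_at_max[OF smooth_u[OF t] smooth open_ball True]) auto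
    also have "\<dots> = (2 * k * DIM('a) + 4 * k\<^sup>2 * (x \<bullet> x)) * exp (k * (x \<bullet> x - R\<^sup>2))"
      unfolding b by (rule boundary_layer_partials(2))
    also have "\<dots> \<le> (2 * k * DIM('a) + 4 * k\<^sup>2 * R\<^sup>2) * 1"
      using k xR by (intro mult_mono add_mono) (auto simp: mult_nonneg_nonpos)
    also have "\<dots> = exp (M + 3) * DIM('a) / R + exp (2 * M) * exp 6"
    proof -
      have "4 * k\<^sup>2 * R\<^sup>2 = (exp (M + 3))\<^sup>2" unfolding k(2)[symmetric] by (simp add: power_mult_distrib)
      also have "\<dots> = exp (2 * M) * exp 6" by (simp add: power2_eq_square flip: exp_add)
      finally show ?thesis by (simp add: k_def)
    qed
    also have "exp (M + 3) * DIM('a) / R \<le> exp (2 * M) * (exp 3 * DIM('a) / R)"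
      using \<open>0 \<le> M\<close> R by (simp add: exp_add divide_right_mono mult_right_mono)
    finally have lap: "laplacian (\<lambda>y. u y t) x \<le> exp (2 * M) * (exp 3 * DIM('a) / R + exp 6)"
      by (simp add: algebra_simps)
    have "exp (M + 2) \<le> exp (2 * M) * exp 2" using \<open>0 \<le> M\<close> by (simp flip: exp_add)
    with v2 have "exp (v x t) \<le> exp (2 * M) * exp 2" by (rule order.trans)
    then have "lam * exp (v x t) \<le> lam * (exp (2 * M) * exp 2)"
      using lam by (intro mult_left_mono) auto
    moreover have "0 \<le> (laplacian (\<lambda>y. u y t) x + lam * exp (v x t)) - growth_const * exp (2 * M)"
    proof (rule left_derivative_nonneg_at_max[OF _ \<open>t0 < t\<close>])
      show "((\<lambda>s. u x s - barrier M t0 x s) has_real_derivative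
          (laplacian (\<lambda>y. u y t) x + lam * exp (v x t)) - growth_const * exp (2 * M)) (at t within {..t})"
        unfolding barrier_def
        by (intro DERIV_diff has_field_derivative_at_within[OF heat_u[OF True t]])
           (auto intro!: derivative_eq_intros)
      show "u x s - barrier M t0 x s \<le> u x t - barrier M t0 x t" if "t0 \<le> s" "s < t" for s
        using below[OF x, of s] that contact by simp
    qed
    moreover have "growth_const * exp (2 * M)
        = exp (2 * M) + exp (2 * M) * (exp 3 * DIM('a) / R + exp 6) + lam * (exp (2 * M) * exp 2)"
      by (simp add: growth_const_def algebra_simps)
    ultimately have "exp (2 * M) \<le> 0" using lap by linarith
    then show False by simp
  next
    case False
    then have sph: "x \<in> sphere 0 R" using x by auto
    have "has_normal_derivative R (\<lambda>y. barrier M t0 y t) (2 * k * R) x"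
      unfolding b by (rule boundary_layer_partials(3)[OF R sph])
    then have "2 * k * R \<le> exp (v x t)"
      using max by (intro normal_derivative_le_at_max[OF R sph flux_u[OF sph t] _ zero_less_one]) auto
    moreover have "exp (M + 2) < exp (M + 3)" by simp
    ultimately show False using v2 k(2) by linarith
  qed
qed

lemma bounded_by_barrier:
  assumes "0 \<le> M" "0 < t0" "t0 \<le> t" "t < T"
    and start: "\<And>y. y \<in> cball 0 R \<Longrightarrow> u y t0 \<le> M \<and> v y t0 \<le> M"
    and life: "growth_const * exp (2 * M) * (t - t0) \<le> 1"
    and x: "x \<in> cball 0 R"
  shows "u x t \<le> M + 2 \<and> v x t \<le> M + 2"
proof -
  define f where "f y s = max (u y s) (v y s) - barrier M t0 y s" for y s
  have "f x t \<le> 0"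
  proof (rule ccontr)
    assume "\<not> f x t \<le> 0"
    moreover have "continuous_on (cball 0 R \<times> {t0..t}) (\<lambda>(y, s). f y s)"
      using continuous_on_compact[of t t0] \<open>0 < t0\<close> \<open>t < T\<close> R
      by (auto simp: f_def barrier_def split_beta intro!: continuous_intros)
    moreover have "f y t0 < 0" if "y \<in> cball 0 R" for y
      using start[OF that] by (auto simp: f_def barrier_def intro: le_less_trans)
    ultimately obtain y s where y: "y \<in> cball 0 R" "t0 < s" "s \<le> t" "f y s = 0"
      and le: "\<And>z r. z \<in> cball 0 R \<Longrightarrow> r \<in> {t0..s} \<Longrightarrow> f z r \<le> 0"
      using first_contact[of "cball 0 R" t0 t f x t] x \<open>t0 \<le> t\<close> by (auto simp: not_le)
    have s: "s \<in> {0<..<T}" using y assms by auto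
    have "growth_const * exp (2 * M) * (s - t0) \<le> growth_const * exp (2 * M) * (t - t0)"
      using growth_const_pos y by (intro mult_left_mono) auto
    then have ls: "growth_const * exp (2 * M) * (s - t0) \<le> 1" using life by simp
    have below: "u z r \<le> barrier M t0 z r" "v z r \<le> barrier M t0 z r"
      if "z \<in> cball 0 R" "r \<in> {t0..s}" for z r
      using le[OF that] by (auto simp: f_def)
    have below_y: "u y s \<le> barrier M t0 y s" "v y s \<le> barrier M t0 y s"
      using below[OF y(1), of s] y by auto
    interpret sw: heat_system R lam T v u by (rule swapped)
    consider "u y s = barrier M t0 y s" | "v y s = barrier M t0 y s"
      using y(4) unfolding f_def by linarith
    then show False
    proof cases
      case 1
      then show False
        using barrier_not_touched[OF \<open>0 \<le> M\<close> y(1) s y(2) ls _ below_y(2) below(1)] by blast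
    next
      case 2
      then show False
        using sw.barrier_not_touched[OF \<open>0 \<le> M\<close> y(1) s y(2) ls _ below_y(1) below(2)] by blast
    qed
  qed
  then show ?thesis using barrier_le[OF x life] by (simp add: f_def)
qed

lemma remaining_time:
  assumes blow_up: "\<And>N. \<exists>\<^sub>F t in at_left T.
      N < sup_norm_on (ball 0 R) (\<lambda>x. u x t) + sup_norm_on (ball 0 R) (\<lambda>x. v x t)"
    and "0 \<le> M" and t0: "t0 \<in> {0<..<T}"
    and start: "\<And>y. y \<in> cball 0 R \<Longrightarrow> u y t0 \<le> M \<and> v y t0 \<le> M"
  shows "1 \<le> growth_const * exp (2 * M) * (T - t0)"
proof (rule ccontr)
  assume short: "\<not> ?thesis"
  interpret sw: heat_system R lam T v u by (rule swapped)
  have "sup_norm_on (ball 0 R) (\<lambda>x. u x t) + sup_norm_on (ball 0 R) (\<lambda>x. v x t) \<le> 2 * (M + 2)"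
    if t: "t0 < t" "t < T" for t
  proof -
    have "growth_const * exp (2 * M) * (t - t0) \<le> growth_const * exp (2 * M) * (T - t0)"
      using growth_const_pos t by (intro mult_left_mono) auto
    then have "growth_const * exp (2 * M) * (t - t0) \<le> 1" using short by simp
    then have up: "u x t \<le> M + 2 \<and> v x t \<le> M + 2" if "x \<in> ball 0 R" for x
      using that t t0 start by (intro bounded_by_barrier[OF \<open>0 \<le> M\<close>, of t0]) auto
    have "\<bar>u x t\<bar> \<le> M + 2" "\<bar>v x t\<bar> \<le> M + 2" if "x \<in> ball 0 R" for x
      using up[OF that] above_minus_one[of x t] sw.above_minus_one[of x t] that t t0 \<open>0 \<le> M\<close>
      by (auto simp: abs_le_iff)
    then have "sup_norm_on (ball 0 R) (\<lambda>x. u x t) \<le> M + 2" "sup_norm_on (ball 0 R) (\<lambda>x. v x t) \<le> M + 2"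
      unfolding sup_norm_on_def using R by (auto intro!: cSUP_least)
    then show ?thesis by simp
  qed
  then have "\<forall>\<^sub>F t in at_left T. \<not> 2 * (M + 2)
      < sup_norm_on (ball 0 R) (\<lambda>x. u x t) + sup_norm_on (ball 0 R) (\<lambda>x. v x t)"
    unfolding not_less eventually_at_left_field using t0 by auto
  then show False using blow_up[of "2 * (M + 2)"] by (simp add: frequently_def)
qed

text \<open>By monotonicity and the bounded difference, \<open>M = u e t + K\<close> bounds both components at
  time \<open>t\<close>; the constant \<open>K \<ge> 1\<close> also makes \<open>M\<close> nonnegative.\<close>

lemma lower_rate:
  assumes blow_up: "\<And>N. \<exists>\<^sub>F t in at_left T.
      N < sup_norm_on (ball 0 R) (\<lambda>x. u x t) + sup_norm_on (ball 0 R) (\<lambda>x. v x t)"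
    and "0 < T" and e: "norm e = R"
  shows "\<exists>C. \<forall>t\<in>{0<..<T}. C - 1 / 2 * ln (T - t) \<le> u e t"
proof -
  interpret sw: heat_system R lam T v u by (rule swapped)
  obtain B where B: "\<And>x t. x \<in> cball 0 R \<Longrightarrow> t \<in> {0..0} \<Longrightarrow> u x t \<le> B \<and> v x t \<le> B"
    using bounded_above[OF \<open>0 < T\<close>] by blast
  define K where "K = \<bar>B\<bar> + 1"
  have eb: "e \<in> cball 0 R" using e by simp
  have init: "v x 0 - u x 0 < K" if "x \<in> cball 0 R" for x
  proof -
    have "v x 0 \<le> B" using B[OF that, of 0] by simp
    then show ?thesis using init_u[OF that] by (simp add: K_def)
  qed
  have "0 < K" by (simp add: K_def)
  note K = sw.difference_bounded[OF this init eb]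
  show ?thesis
  proof (intro exI[of _ "- K - ln growth_const / 2"] ballI)
    fix t assume t: "t \<in> {0<..<T}"
    define M where "M = u e t + K"
    have "0 \<le> M" using above_minus_one[OF eb, of t] t by (simp add: M_def K_def)
    moreover have "u y t \<le> M \<and> v y t \<le> M" if y: "y \<in> cball 0 R" for y
    proof -
      have "norm y \<le> norm e" "t \<in> {0..<T}" using y e t by auto
      then have "u y t \<le> u e t" "v y t \<le> v e t" "v e t < u e t + K"
        using radially_nondecreasing[OF y eb] K[of t] by auto
      then show ?thesis using \<open>0 < K\<close> by (simp add: M_def)
    qed
    ultimately have "1 \<le> growth_const * exp (2 * M) * (T - t)"
      using remaining_time[OF blow_up _ t] by blast
    then have "0 \<le> ln (growth_const * exp (2 * M) * (T - t))" by simp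
    also have "\<dots> = ln growth_const + 2 * M + ln (T - t)"
      using growth_const_pos t by (simp add: ln_mult)
    finally show "(- K - ln growth_const / 2) - 1 / 2 * ln (T - t) \<le> u e t"
      by (simp add: M_def)
  qed
qed

end

section \<open>From classical solutions to the system\<close>

lemma norm_some_unit: "norm (SOME e::'a::euclidean_space. norm e = 1) = 1"
proof (rule someI_ex)
  show "\<exists>e::'a. norm e = 1" by (rule vector_choose_size[of 1]) auto
qed

lemma radial_profile_norm:
  fixes f :: "'a::euclidean_space \<Rightarrow> real"
  assumes "radial_on (cball 0 R) f" "x \<in> cball 0 R"
  shows "radial_profile f (norm x) = f x"
proof -
  let ?y = "norm x *\<^sub>R (SOME e::'a. norm e = 1)"
  have "norm ?y = norm x" by (simp add: norm_some_unit)
  moreover from this have "?y \<in> cball 0 R" using assms(2) by (simp only: mem_cball_0)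
  ultimately show ?thesis
    using assms unfolding radial_profile_def radial_on_def by blast
qed

lemma profile_monoD:
  fixes f :: "'a::euclidean_space \<Rightarrow> real"
  assumes f: "radial_on (cball 0 R) f" "mono_on {0..R} (radial_profile f)"
    and x: "x \<in> cball 0 R" and y: "y \<in> cball 0 R" and xy: "norm x \<le> norm y"
  shows "f x \<le> f y"
proof -
  have "radial_profile f (norm x) \<le> radial_profile f (norm y)"
    using x y by (intro mono_onD[OF f(2)] xy) auto
  then show ?thesis by (simp only: radial_profile_norm[OF f(1)] x y)
qed

text \<open>The initial condition is prescribed on the open ball; continuity carries it to the
  sphere.\<close>

lemma initial_value_on_cball:
  fixes f0 :: "'a::euclidean_space \<Rightarrow> real" and f :: "'a \<Rightarrow> real \<Rightarrow> real"
  assumes "0 < R" "0 < T" "smooth_on_closed (cball 0 R) f0"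
    and cont: "continuous_on (cball 0 R \<times> {0..<T}) (\<lambda>(x, t). f x t)"
    and init: "\<forall>x\<in>ball 0 R. f x 0 = f0 x" and x: "x \<in> cball 0 R"
  shows "f x 0 = f0 x"
proof -
  obtain S where "cball 0 R \<subseteq> S" "Ck_on 0 S f0"
    using assms(3) unfolding smooth_on_closed_def by blast
  then have f0: "continuous_on (cball 0 R) f0" using continuous_on_subset by auto
  have "continuous_on (cball 0 R) (\<lambda>x. case (x, 0) of (x, t) \<Rightarrow> f x t)"
  proof (rule continuous_on_compose2[OF cont])
    show "continuous_on (cball 0 R) (\<lambda>x::'a. (x, 0::real))" by (intro continuous_intros)
  qed (use \<open>0 < T\<close> in auto)
  then have "continuous_on (closure (ball 0 R)) (\<lambda>x. f x 0 - f0 x)"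
    using f0 \<open>0 < R\<close> by (simp add: continuous_on_diff)
  moreover have "f y 0 - f0 y = 0" if "y \<in> ball 0 R" for y using init that by simp
  moreover have "x \<in> closure (ball 0 R)" using x \<open>0 < R\<close> by simp
  ultimately have "f x 0 - f0 x = 0" by (rule continuous_constant_on_closure)
  then show ?thesis by simp
qed

lemma heat_system_of_classical_solution:
  fixes u0 v0 :: "'a::euclidean_space \<Rightarrow> real"
  assumes R: "0 < R" and lam: "0 < lam" and init: "standing_assumptions R u0 v0"
    and sol: "classical_solution lam lam R u0 v0 T u v"
  shows "heat_system R lam T u v"
proof -
  have T: "0 < T" using sol by (simp add: classical_solution_def)
  have cont: "continuous_on (cball 0 R \<times> {0..<T}) (\<lambda>(x, t). u x t)"
    "continuous_on (cball 0 R \<times> {0..<T}) (\<lambda>(x, t). v x t)"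
    and start: "\<forall>x\<in>ball 0 R. u x 0 = u0 x \<and> v x 0 = v0 x"
    and C: "C21_on (ball 0 R) T u" "C21_on (ball 0 R) T v"
    and radial: "\<forall>t\<in>{0..<T}. radial_on (cball 0 R) (\<lambda>x. u x t) \<and> radial_on (cball 0 R) (\<lambda>x. v x t)"
    and pde: "\<forall>x\<in>ball 0 R. \<forall>t\<in>{0<..<T}.
        deriv (u x) t = laplacian (\<lambda>y. u y t) x + lam * exp (v x t) \<and>
        deriv (v x) t = laplacian (\<lambda>y. v y t) x + lam * exp (u x t)"
    and flux: "\<forall>x\<in>sphere 0 R. \<forall>t\<in>{0<..<T}.
        has_normal_derivative R (\<lambda>y. u y t) (exp (v x t)) x \<and>
        has_normal_derivative R (\<lambda>y. v y t) (exp (u x t)) x"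
    using sol unfolding classical_solution_def by - (elim conjE, assumption)+
  have data: "smooth_on_closed (cball 0 R) u0" "smooth_on_closed (cball 0 R) v0"
    "radial_on (cball 0 R) u0" "radial_on (cball 0 R) v0"
    "mono_on {0..R} (radial_profile u0)" "mono_on {0..R} (radial_profile v0)"
    "\<forall>x\<in>cball 0 R. 0 \<le> u0 x \<and> 0 \<le> v0 x"
    using init unfolding standing_assumptions_def by - (elim conjE, assumption)+
  have "\<forall>x\<in>ball 0 R. u x 0 = u0 x" "\<forall>x\<in>ball 0 R. v x 0 = v0 x" using start by simp_all
  note u0 = initial_value_on_cball[OF R T data(1) cont(1) this(1)]
    and v0 = initial_value_on_cball[OF R T data(2) cont(2) this(2)]
  have smooth: "twice_partial_on (ball 0 R) (\<lambda>y. w y t)"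
    if "C21_on (ball 0 R) T w" "t \<in> {0<..<T}" for w :: "'a \<Rightarrow> real \<Rightarrow> real" and t
    using that by (simp add: C21_on_def twice_partial_on_def)
  have time: "(w x has_real_derivative deriv (w x) t) (at t)"
    if "C21_on (ball 0 R) T w" "x \<in> ball 0 R" "t \<in> {0<..<T}" for w :: "'a \<Rightarrow> real \<Rightarrow> real" and x t
    using that by (simp add: C21_on_def DERIV_deriv_iff_real_differentiable)
  show ?thesis
  proof
    show "(u x has_real_derivative laplacian (\<lambda>y. u y t) x + lam * exp (v x t)) (at t)"
      "(v x has_real_derivative laplacian (\<lambda>y. v y t) x + lam * exp (u x t)) (at t)"
      if "x \<in> ball 0 R" "t \<in> {0<..<T}" for x t
    proof -
      have "deriv (u x) t = laplacian (\<lambda>y. u y t) x + lam * exp (v x t)"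
        "deriv (v x) t = laplacian (\<lambda>y. v y t) x + lam * exp (u x t)"
        using bspec[OF bspec[OF pde that(1)] that(2)] by blast+
      then show "(u x has_real_derivative laplacian (\<lambda>y. u y t) x + lam * exp (v x t)) (at t)"
        "(v x has_real_derivative laplacian (\<lambda>y. v y t) x + lam * exp (u x t)) (at t)"
        using time[OF C(1) that] time[OF C(2) that] by metis+
    qed
    show "u x t = u y t" "v x t = v y t"
      if "x \<in> cball 0 R" "y \<in> cball 0 R" "norm x = norm y" "t \<in> {0..<T}" for x y t
      using bspec[OF radial that(4)] that(1-3) unfolding radial_on_def by blast+
    show "u x 0 \<le> u y 0" "v x 0 \<le> v y 0"
      if "x \<in> cball 0 R" "y \<in> cball 0 R" "norm x \<le> norm y" for x y
      using profile_monoD[OF data(3,5) that] profile_monoD[OF data(4,6) that]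
      by (simp_all only: u0[OF that(1)] u0[OF that(2)] v0[OF that(1)] v0[OF that(2)])
    show "0 \<le> u x 0" "0 \<le> v x 0" if "x \<in> cball 0 R" for x
      using data(7) that by (simp_all only: u0[OF that] v0[OF that])
    show "twice_partial_on (ball 0 R) (\<lambda>y. u y t)" "twice_partial_on (ball 0 R) (\<lambda>y. v y t)"
      if "t \<in> {0<..<T}" for t
      using smooth[OF C(1) that] smooth[OF C(2) that] .
    show "has_normal_derivative R (\<lambda>y. u y t) (exp (v x t)) x"
      "has_normal_derivative R (\<lambda>y. v y t) (exp (u x t)) x"
      if "x \<in> sphere 0 R" "t \<in> {0<..<T}" for x t
      using bspec[OF bspec[OF flux that(1)] that(2)] by blast+
    show "continuous_on (cball 0 R \<times> {0..<T}) (\<lambda>(x, t). u x t)"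
      "continuous_on (cball 0 R \<times> {0..<T}) (\<lambda>(x, t). v x t)"
      by (rule cont)+
  qed (rule R lam)+
qed

theorem theorem3p1:
  fixes u0 v0 :: "real ^ 'n \<Rightarrow> real"
    and u v :: "real ^ 'n \<Rightarrow> real \<Rightarrow> real"
    and R T lam :: real
  assumes "0 < R" and "0 < lam"
    and "standing_assumptions R u0 v0"
    and "blow_up_solution lam lam R u0 v0 T u v"
    and "\<forall>r\<in>{0..R}. 0 \<le> deriv (radial_profile u0) r - r / R * exp (radial_profile v0 r)"
    and "\<forall>r\<in>{0..R}. 0 \<le> deriv (radial_profile v0) r - r / R * exp (radial_profile u0 r)"
  shows "\<exists>c>0. \<forall>t\<in>{0<..<T}.
           ln c - 1 / 2 * ln (T - t) \<le> radial_profile (\<lambda>x. u x t) R \<and>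
           ln c - 1 / 2 * ln (T - t) \<le> radial_profile (\<lambda>x. v x t) R"
proof -
  note blow_up = assms(4)[unfolded blow_up_solution_def]
  note sol = conjunct1[OF blow_up] and blow = spec[OF conjunct2[OF conjunct2[OF blow_up]]]
  have blow_swapped: "\<exists>\<^sub>F t in at_left T.
      N < sup_norm_on (ball 0 R) (\<lambda>x. v x t) + sup_norm_on (ball 0 R) (\<lambda>x. u x t)" for N
    using blow[of N] by (simp only: add.commute)
  interpret heat_system R lam T u v
    using heat_system_of_classical_solution[OF assms(1-3) sol] .
  interpret sw: heat_system R lam T v u by (rule swapped)
  have T: "0 < T" using sol by (simp add: classical_solution_def)
  define e :: "real ^ 'n" where "e = R *\<^sub>R (SOME e. norm e = 1)"
  have e: "norm e = R" using \<open>0 < R\<close> by (simp add: e_def norm_some_unit)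
  have profile: "radial_profile f R = f e" for f by (simp add: radial_profile_def e_def)
  obtain C1 where C1: "\<forall>t\<in>{0<..<T}. C1 - 1 / 2 * ln (T - t) \<le> u e t"
    using lower_rate[OF blow T e] by blast
  obtain C2 where C2: "\<forall>t\<in>{0<..<T}. C2 - 1 / 2 * ln (T - t) \<le> v e t"
    using sw.lower_rate[OF blow_swapped T e] by blast
  show ?thesis
    unfolding profile
  proof (intro exI[of _ "exp (min C1 C2)"] conjI ballI)
    fix t assume t: "t \<in> {0<..<T}"
    show "ln (exp (min C1 C2)) - 1 / 2 * ln (T - t) \<le> u e t"
      "ln (exp (min C1 C2)) - 1 / 2 * ln (T - t) \<le> v e t"
      using bspec[OF C1 t] bspec[OF C2 t] unfolding ln_exp by linarith+
  qed simp
qed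

end
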